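(* Let $K,t,s$ be positive integers with $t\ge 2$, $t\mid K$ and $s\le K$, and put $r=t$. Then there exists a CDC scheme with $K$ nodes, $N=\left(\frac{K}{r}\right)^{r-1}$ files and $Q=\frac{K}{\gcd(K,s)}$ output functions, where $s$ is the number of nodes that compute each output function, with computation load $r$ and communication load $\frac{s}{r-1}\left(1-\frac{r}{K}\right)$. Moreover, when this value exceeds $1$, one can instead let each IVA be multicast uncoded by one node that can compute it locally, so that the communication load is $L_2(r,s)=\min\left\{\frac{s}{r-1}\left(1-\frac{r}{K}\right),1\right\}$.
   Context: **CDC (coded distributed computing) scheme.** There are $K$ nodes $0,\dots,K-1$, $N$ files $w_0,\dots,w_{N-1}\in\mathbb F_{2^D}$, and $Q$ output functions $\phi_0,\dots,\phi_{Q-1}$ with $\phi_q:\mathbb F_{2^D}^N\to\mathbb F_{2^B}$. Each output function decomposes as $\phi_q(w_0,\dots,w_{N-1})=h_q(v_{q,0},\dots,v_{q,N-1})$, where $v_{q,n}=g_{q,n}(w_n)\in\mathbb F_{2^T}$ is called an intermediate value (IVA), for a given positive integer $T$, with map functions $g_{q,n}:\mathbb F_{2^D}\to\mathbb F_{2^T}$ and reduce functions $h_q:\mathbb F_{2^T}^N\to\mathbb F_{2^B}$. A CDC scheme consists of: - for each node $k$, a set $\mathcal W_k$ of stored files and a set $\mathcal Q_k$ of output functions it must compute; in the map phase node $k$ computes locally the IVAs $\mathcal C_k=\{v_{q,n}: 0\le q\le Q-1,\ w_n\in\mathcal W_k\}$; - (shuffle phase) for each node $k$, a message $X_k$ of $l_k$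 bits which is a function of $\mathcal C_k$ and is multicast to all other nodes, each of which receives it error-free; - (reduce phase) decoding functions by which each node $k$, from $X_0,\dots,X_{K-1}$ and $\mathcal C_k$, recovers all $v_{q,n}$ with $\phi_q\in\mathcal Q_k$ and $0\le n\le N-1$, and hence computes the output functions in $\mathcal Q_k$. The computation load is $\frac{1}{N}\sum_{k=0}^{K-1}|\mathcal W_k|$ and the communication load is $\frac{1}{QNT}\sum_{k=0}^{K-1} l_k$. The nodes that compute $\phi_q$ are those $k$ with $\phi_q\in\mathcal Q_k$.
   Formalization: The load s/(r-1)·(1-r/K), and L_2 when that value is at most 1, is proved only when r-1 divides the IVA length T; for arbitrary T the claim fails, e.g. K=8, r=4, s=1, T=1 would need 32/3 bits in total. *)

theory Defs
  imports Complex_Main "HOL-Library.FuncSet"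
begin

text \<open>
  Elements of the field with \<open>2 ^ m\<close> elements only serve as words of \<open>m\<close> bits (no field operation
  occurs in the model), so they are represented by bit strings of length \<open>m\<close>. Nodes, files and
  output functions are the naturals below \<open>K\<close>, \<open>N\<close> and \<open>Q\<close>. Tuples indexed by \<open>{..<n}\<close> are
  extensional functions, and families of IVAs are indexed by pairs \<open>(q, n)\<close>.
\<close>

type_synonym bits = "bool list"

definition bit_strings :: "nat \<Rightarrow> bits set" where
  "bit_strings m = {x. length x = m}"

locale cdc_problem =
  fixes N Q D B T :: nat
    and g :: "nat \<Rightarrow> nat \<Rightarrow> bits \<Rightarrow> bits"
    and h :: "nat \<Rightarrow> (nat \<Rightarrow> bits) \<Rightarrow> bits"
    and \<phi> :: "nat \<Rightarrow> (nat \<Rightarrow> bits) \<Rightarrow> bits"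
  assumes pos: "0 < D" "0 < B" "0 < T"
    and map_fun: "\<And>q n. q < Q \<Longrightarrow> n < N \<Longrightarrow> g q n \<in> bit_strings D \<rightarrow> bit_strings T"
    and reduce_fun: "\<And>q. q < Q \<Longrightarrow> h q \<in> ({..<N} \<rightarrow>\<^sub>E bit_strings T) \<rightarrow> bit_strings B"
    and decomposition:
      "\<And>q w. q < Q \<Longrightarrow> w \<in> {..<N} \<rightarrow>\<^sub>E bit_strings D \<Longrightarrow>
        \<phi> q w = h q (\<lambda>n\<in>{..<N}. g q n (w n))"

record cdc =
  stored :: "nat \<Rightarrow> nat set"
  assigned :: "nat \<Rightarrow> nat set"
  msg_len :: "nat \<Rightarrow> nat"
  encode :: "nat \<Rightarrow> (nat \<times> nat \<Rightarrow> bits) \<Rightarrow> bits"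
  decode :: "nat \<Rightarrow> (nat \<Rightarrow> bits) \<Rightarrow> (nat \<times> nat \<Rightarrow> bits) \<Rightarrow> nat \<times> nat \<Rightarrow> bits"

definition iva :: "(nat \<Rightarrow> nat \<Rightarrow> bits \<Rightarrow> bits) \<Rightarrow> (nat \<Rightarrow> bits) \<Rightarrow> nat \<times> nat \<Rightarrow> bits" where
  "iva g w = (\<lambda>(q, n). g q n (w n))"

text \<open>
  The family of IVAs that node \<open>k\<close> computes in the map phase. Restricting it to the stored files
  makes messages and decoded values depend on nothing else that is known from the map phase.
\<close>

definition local_ivas :: "nat \<Rightarrow> cdc \<Rightarrow> (nat \<times> nat \<Rightarrow> bits) \<Rightarrow> nat \<Rightarrow> nat \<times> nat \<Rightarrow> bits" where
  "local_ivas Q S v k = restrict v ({..<Q} \<times> stored S k)"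

definition message :: "nat \<Rightarrow> cdc \<Rightarrow> (nat \<times> nat \<Rightarrow> bits) \<Rightarrow> nat \<Rightarrow> bits" where
  "message Q S v k = encode S k (local_ivas Q S v k)"

definition recovered :: "nat \<Rightarrow> nat \<Rightarrow> cdc \<Rightarrow> (nat \<times> nat \<Rightarrow> bits) \<Rightarrow> nat \<Rightarrow> nat \<times> nat \<Rightarrow> bits" where
  "recovered K Q S v k = decode S k (\<lambda>j\<in>{..<K}. message Q S v j) (local_ivas Q S v k)"

text \<open>
  A scheme has to serve every choice of map, reduce and output functions and all file contents;
  only the IVA length \<open>T\<close> is known to it.
\<close>

definition cdc_scheme :: "nat \<Rightarrow> nat \<Rightarrow> nat \<Rightarrow> nat \<Rightarrow> cdc \<Rightarrow> bool" where
  "cdc_scheme K N Q T S \<longleftrightarrow>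
    (\<forall>k<K. stored S k \<subseteq> {..<N} \<and> assigned S k \<subseteq> {..<Q}) \<and>
    (\<forall>D B g h \<phi> w. cdc_problem N Q D B T g h \<phi> \<longrightarrow> w \<in> {..<N} \<rightarrow>\<^sub>E bit_strings D \<longrightarrow>
      (\<forall>k<K.
        message Q S (iva g w) k \<in> bit_strings (msg_len S k) \<and>
        (\<forall>q\<in>assigned S k.
          (\<forall>n<N. recovered K Q S (iva g w) k (q, n) = iva g w (q, n)) \<and>
          h q (\<lambda>n\<in>{..<N}. recovered K Q S (iva g w) k (q, n)) = \<phi> q w)))"

definition computing_nodes :: "nat \<Rightarrow> (nat \<Rightarrow> nat set) \<Rightarrow> nat \<Rightarrow> nat set" where
  "computing_nodes K A q = {k. k < K \<and> q \<in> A k}"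

definition computation_load :: "nat \<Rightarrow> nat \<Rightarrow> (nat \<Rightarrow> nat set) \<Rightarrow> real" where
  "computation_load K N W = (\<Sum>k<K. real (card (W k))) / real N"

definition communication_load :: "nat \<Rightarrow> nat \<Rightarrow> nat \<Rightarrow> nat \<Rightarrow> cdc \<Rightarrow> real" where
  "communication_load K N Q T S = (\<Sum>k<K. real (msg_len S k)) / (real Q * real N * real T)"

text \<open>
  \<open>P k\<close> lists the indices of the IVAs that node \<open>k\<close> multicasts in the clear; every IVA is sent
  exactly once, by a node that stores the corresponding file.
\<close>

definition uncoded_multicast :: "nat \<Rightarrow> nat \<Rightarrow> nat \<Rightarrow> cdc \<Rightarrow> bool" where
  "uncoded_multicast K N Q S \<longleftrightarrow>
    (\<exists>P :: nat \<Rightarrow> (nat \<times> nat) list.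
      (\<forall>k<K. distinct (P k) \<and> set (P k) \<subseteq> {..<Q} \<times> stored S k \<and>
        (\<forall>c. encode S k c = concat (map c (P k)))) \<and>
      (\<forall>p\<in>{..<Q} \<times> {..<N}. \<exists>!k. k < K \<and> p \<in> set (P k)))"

end

theory Submission
  imports Defs
begin

text \<open>
  Put \<open>m = K / r\<close> and identify the nodes with pairs \<open>(i, a)\<close>, \<open>i < r\<close>, \<open>a < m\<close>, and the files with
  the words of length \<open>r\<close> over the integers modulo \<open>m\<close> whose letters sum to zero; node \<open>(i, a)\<close> stores
  the words with letter \<open>a\<close> at position \<open>i\<close>. A word \<open>y\<close> with nonzero sum yields a multicast group of the
  nodes \<open>(i, y i)\<close>: the unique file that differs from \<open>y\<close> at position \<open>i\<close> only is missing at
  \<open>(i, y i)\<close> and stored at the \<open>r - 1\<close> other nodes of the group. Every IVA wanted in the group is cut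
  into \<open>r - 1\<close> pieces, one for each node that can compute it, and every node multicasts the sum modulo 2
  of its pieces. All missing pairs of a node and a file arise in this way, and the groups are used
  once for each of the \<open>s / gcd K s\<close> functions that a node computes.
\<close>

section \<open>Schemes from messages that determine the IVAs\<close>

text \<open>Entries outside the index range are left free, so every \<open>iva g w\<close> built
  from admissible map functions and files belongs to this set.\<close>

definition iva_families :: "nat \<Rightarrow> nat \<Rightarrow> nat \<Rightarrow> (nat \<times> nat \<Rightarrow> bits) set" where
  "iva_families N Q T = {v. \<forall>q<Q. \<forall>n<N. length (v (q, n)) = T}"

text \<open>Explicit decoders can be avoided: a node picks any family of IVAs consistent with what
  it stores and receives. By \<open>det\<close>, this choice agrees with the true family on all
  entries that the node wants.\<close>

lemma cdc_scheme_if_determined: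
  fixes K N Q T :: nat and W A :: "nat \<Rightarrow> nat set" and len :: "nat \<Rightarrow> nat"
    and enc :: "nat \<Rightarrow> (nat \<times> nat \<Rightarrow> bits) \<Rightarrow> bits"
  defines "loc \<equiv> \<lambda>v k. restrict v ({..<Q} \<times> W k)"
  assumes bounds: "\<And>k. k < K \<Longrightarrow> W k \<subseteq> {..<N}" "\<And>k. k < K \<Longrightarrow> A k \<subseteq> {..<Q}"
    and len: "\<And>k v. k < K \<Longrightarrow> v \<in> iva_families N Q T \<Longrightarrow> length (enc k (loc v k)) = len k"
    and det: "\<And>k v v' q n. \<lbrakk>k < K; v \<in> iva_families N Q T; v' \<in> iva_families N Q T;
        loc v k = loc v' k; \<And>j. j < K \<Longrightarrow> enc j (loc v j) = enc j (loc v' j);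
        q \<in> A k; n < N\<rbrakk> \<Longrightarrow> v (q, n) = v' (q, n)"
  shows "\<exists>S. cdc_scheme K N Q T S \<and> stored S = W \<and> assigned S = A \<and> msg_len S = len \<and>
    encode S = enc"
proof -
  \<comment> \<open>Consistency of a candidate family \<open>v\<close> with the messages
    \<open>X\<close> and the local IVAs \<open>c\<close>. The true family is always a candidate, so
    the choice below is well-founded.\<close>
  define fits where "fits = (\<lambda>k X c v. v \<in> iva_families N Q T \<and> c = loc v k \<and>
    X = (\<lambda>j\<in>{..<K}. enc j (loc v j)))"
  define S where "S = \<lparr>stored = W, assigned = A, msg_len = len, encode = enc,
    decode = (\<lambda>k X c. SOME v. fits k X c v)\<rparr>"
  have loc: "local_ivas Q S v k = loc v k" for v k
    by (simp add: local_ivas_def S_def loc_def)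
  have msg: "message Q S v k = enc k (loc v k)" for v k
    by (simp add: message_def loc) (simp add: S_def)
  have recov: "recovered K Q S v k (q, n) = v (q, n)"
    if v: "v \<in> iva_families N Q T" and k: "k < K" and q: "q \<in> A k" and n: "n < N" for v k q n
  proof -
    define X where "X = (\<lambda>j\<in>{..<K}. enc j (loc v j))"
    define v' where "v' = (SOME v'. fits k X (loc v k) v')"
    have "fits k X (loc v k) v"
      using v by (simp add: fits_def X_def)
    then have v': "fits k X (loc v k) v'"
      unfolding v'_def by (rule someI[of "fits k X (loc v k)"])
    have "enc j (loc v' j) = enc j (loc v j)" if "j < K" for j
    proof -
      have "X = (\<lambda>j\<in>{..<K}. enc j (loc v' j))"
        using v' by (simp only: fits_def)
      then have "(\<lambda>j\<in>{..<K}. enc j (loc v j)) j = (\<lambda>j\<in>{..<K}. enc j (loc v' j)) j"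
        by (simp only: X_def)
      then show ?thesis using that by simp
    qed
    moreover have "v' \<in> iva_families N Q T" "loc v' k = loc v k"
      using v' by (simp_all only: fits_def)
    ultimately have "v' (q, n) = v (q, n)"
      using det[OF k _ v _ _ q n] by blast
    moreover have "recovered K Q S v k = v'"
      by (simp add: recovered_def loc msg) (simp add: S_def v'_def X_def)
    ultimately show ?thesis by simp
  qed
  have "cdc_scheme K N Q T S"
    unfolding cdc_scheme_def
  proof (intro conjI allI impI ballI)
    fix k assume "k < K"
    then show "stored S k \<subseteq> {..<N}" "assigned S k \<subseteq> {..<Q}"
      using bounds by (auto simp: S_def)
  next
    fix D B g h \<phi> w k
    assume prob: "cdc_problem N Q D B T g h \<phi>" and w: "w \<in> {..<N} \<rightarrow>\<^sub>E bit_strings D"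
      and k: "k < K"
    interpret cdc_problem N Q D B T g h \<phi> by (fact prob)
    have v: "iva g w \<in> iva_families N Q T"
      using map_fun w by (fastforce simp: iva_families_def iva_def bit_strings_def)
    then show "message Q S (iva g w) k \<in> bit_strings (msg_len S k)"
      using len k by (simp add: msg bit_strings_def) (simp add: S_def)
    fix q assume "q \<in> assigned S k"
    then have q: "q \<in> A k" by (simp add: S_def)
    show *: "recovered K Q S (iva g w) k (q, n) = iva g w (q, n)" if "n < N" for n
      using recov v k q that by blast
    have "(\<lambda>n\<in>{..<N}. recovered K Q S (iva g w) k (q, n)) = (\<lambda>n\<in>{..<N}. g q n (w n))"
      using * by (auto simp: iva_def intro: restrict_ext)
    then show "h q (\<lambda>n\<in>{..<N}. recovered K Q S (iva g w) k (q, n)) = \<phi> q w"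
      using decomposition[of q w] bounds(2)[OF k] q w by auto
  qed
  then show ?thesis
    by (intro exI[of _ S]) (simp add: S_def)
qed

section \<open>Uncoded multicasting\<close>

text \<open>The sender of a file multicasts all \<open>Q\<close> IVAs of that file. Each IVA thus
  costs \<open>T\<close> bits exactly once, \<open>Q * N * T\<close> bits in total.\<close>

lemma uncoded_multicast_scheme:
  fixes W A :: "nat \<Rightarrow> nat set" and sender :: "nat \<Rightarrow> nat"
  assumes bounds: "\<And>k. k < K \<Longrightarrow> W k \<subseteq> {..<N}" "\<And>k. k < K \<Longrightarrow> A k \<subseteq> {..<Q}"
    and sender: "\<And>n. n < N \<Longrightarrow> sender n < K" "\<And>n. n < N \<Longrightarrow> n \<in> W (sender n)"
    and pos: "0 < N" "0 < Q" "0 < T"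
  shows "\<exists>S. cdc_scheme K N Q T S \<and> stored S = W \<and> assigned S = A \<and>
    uncoded_multicast K N Q S \<and> communication_load K N Q T S = 1"
proof -
  define P where "P k = List.product [0..<Q] (filter (\<lambda>n. sender n = k) [0..<N])" for k
  define enc where "enc k c = concat (map c (P k))" for k and c :: "nat \<times> nat \<Rightarrow> bits"
  define len where "len k = T * length (P k)" for k
  have set_P: "set (P k) = {..<Q} \<times> {n. n < N \<and> sender n = k}" for k
    by (auto simp: P_def)
  have dist: "distinct (P k)" for k
    by (simp add: P_def distinct_product)
  have P_W: "set (P k) \<subseteq> {..<Q} \<times> W k" for k
    using sender by (auto simp: set_P)
  have enc: "enc k (restrict v ({..<Q} \<times> W k)) = concat (map v (P k))" for k v
    unfolding enc_def using P_W by (intro arg_cong[of _ _ concat] map_cong) auto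
  have P_len: "length (v p) = T" if "v \<in> iva_families N Q T" "p \<in> set (P k)" for v p k
    using that by (auto simp: iva_families_def set_P)
  obtain S where S: "cdc_scheme K N Q T S" "stored S = W" "assigned S = A" "msg_len S = len"
      "encode S = enc"
  proof -
    have "\<exists>S. cdc_scheme K N Q T S \<and> stored S = W \<and> assigned S = A \<and> msg_len S = len \<and>
      encode S = enc"
    proof (rule cdc_scheme_if_determined)
      fix k v assume "k < K" "v \<in> iva_families N Q T"
      then have "map (\<lambda>p. length (v p)) (P k) = map (\<lambda>_. T) (P k)"
        using P_len by simp
      then show "length (enc k (restrict v ({..<Q} \<times> W k))) = len k"
        by (simp only: enc len_def length_concat map_map o_def sum_list_triv) simp
    next
      fix k v v' q n
      assume k: "k < K" and v: "v \<in> iva_families N Q T" "v' \<in> iva_families N Q T"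
        and eq: "\<And>j. j < K \<Longrightarrow> enc j (restrict v ({..<Q} \<times> W j)) =
          enc j (restrict v' ({..<Q} \<times> W j))"
        and q: "q \<in> A k" and n: "n < N"
      define j where "j = sender n"
      have "concat (map v (P j)) = concat (map v' (P j))"
        using eq[of j] sender(1)[OF n] by (simp add: enc j_def)
      \<comment> \<open>Blocks of equal length make the concatenation uniquely splittable.\<close>
      moreover have "\<forall>(x, y)\<in>set (zip (map v (P j)) (map v' (P j))). length x = length y"
        using P_len[OF v(1)] P_len[OF v(2)] by (simp add: zip_map_map zip_same_conv_map)
      ultimately have "map v (P j) = map v' (P j)"
        by (subst (asm) concat_eq_concat_iff) auto
      moreover have "(q, n) \<in> set (P j)"
        using q n bounds(2)[OF k] by (auto simp: set_P j_def)
      ultimately show "v (q, n) = v' (q, n)" by simp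
    qed (use bounds in auto)
    then show thesis using that by blast
  qed
  have "uncoded_multicast K N Q S"
    unfolding uncoded_multicast_def
  proof (intro exI[of _ P] conjI allI impI ballI)
    show "\<exists>!k. k < K \<and> p \<in> set (P k)" if "p \<in> {..<Q} \<times> {..<N}" for p
      using that sender(1) by (auto simp: set_P)
  qed (use dist P_W in \<open>auto simp: S enc_def\<close>)
  moreover have "(\<Sum>k<K. len k) = T * (Q * N)"
  proof -
    \<comment> \<open>Double counting of pairs of a sender and a file: each file has exactly one
      sender.\<close>
    have "(\<Sum>k<K. card {n\<in>{..<N}. sender n = k}) = 1 * card {..<N}"
    proof (rule sum_multicount)
      show "\<forall>n\<in>{..<N}. card {k\<in>{..<K}. sender n = k} = 1"
      proof
        fix n assume "n \<in> {..<N}"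
        then have "{k\<in>{..<K}. sender n = k} = {sender n}"
          using sender(1) by auto
        then show "card {k\<in>{..<K}. sender n = k} = 1" by simp
      qed
    qed auto
    moreover have "len k = T * (Q * card {n\<in>{..<N}. sender n = k})" for k
      using distinct_card[OF dist, of k] by (simp add: len_def set_P card_cartesian_product)
    ultimately show ?thesis by (simp flip: sum_distrib_left)
  qed
  then have "communication_load K N Q T S = 1"
    using pos by (simp add: communication_load_def S flip: of_nat_sum)
  ultimately show ?thesis using S by blast
qed

section \<open>Coded multicasting\<close>

text \<open>
  Position \<open>i\<close> of a group \<open>z\<close> is taken by node \<open>node z i\<close>, which wants the IVA \<open>idx z i\<close>. The node at
  position \<open>j\<close> transmits the pieces of the IVAs wanted at the other positions \<open>i\<close>; within such an IVA
  it is in charge of the piece numbered \<open>if j < i then j else j - 1\<close>.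
\<close>

lemma coded_multicast_scheme:
  fixes W A :: "nat \<Rightarrow> nat set" and Z :: "'z set"
    and node :: "'z \<Rightarrow> nat \<Rightarrow> nat" and idx :: "'z \<Rightarrow> nat \<Rightarrow> nat \<times> nat"
  assumes bounds: "\<And>k. k < K \<Longrightarrow> W k \<subseteq> {..<N}" "\<And>k. k < K \<Longrightarrow> A k \<subseteq> {..<Q}"
    and T: "T = (r - 1) * b" and fin: "finite Z"
    and node_less: "\<And>z i. z \<in> Z \<Longrightarrow> i < r \<Longrightarrow> node z i < K"
    and known: "\<And>z i j. z \<in> Z \<Longrightarrow> i < r \<Longrightarrow> j < r \<Longrightarrow> i \<noteq> j \<Longrightarrow>
      idx z i \<in> {..<Q} \<times> W (node z j)"
    and served: "\<And>k q n. k < K \<Longrightarrow> q \<in> A k \<Longrightarrow> n < N \<Longrightarrow> n \<notin> W k \<Longrightarrow>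
      \<exists>z\<in>Z. \<exists>i<r. node z i = k \<and> idx z i = (q, n)"
  shows "\<exists>S. cdc_scheme K N Q T S \<and> stored S = W \<and> assigned S = A \<and>
    (\<Sum>k<K. msg_len S k) = card Z * (r * b)"
proof -
  \<comment> \<open>The slots of node \<open>k\<close>: group \<open>z\<close>, its position
    \<open>j\<close> in the group, and bit offset \<open>u\<close> within a piece of
    \<open>b\<close> bits. One bit is sent per slot.\<close>
  define E where "E k = {(z, j, u). z \<in> Z \<and> j < r \<and> node z j = k \<and> u < b}" for k
  have E_sub: "E k \<subseteq> Z \<times> {..<r} \<times> {..<b}" for k
    by (auto simp: E_def)
  have finE: "finite (E k)" for k
    using fin by (intro finite_subset[OF E_sub]) auto
  obtain es where es: "\<And>k. set (es k) = E k" "\<And>k. distinct (es k)"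
    using finite_distinct_list[OF finE] by metis
  define piece where "piece i j = (if j < i then j else j - 1)" for i j :: nat
  \<comment> \<open>Bit \<open>u\<close> of piece number \<open>c\<close> is bit
    \<open>c * b + u\<close> of an IVA. The parity of the number of ones is the sum modulo 2 of
    these bits over the positions other than \<open>j\<close>.\<close>
  define tx where "tx c = (\<lambda>(z, j, u).
    odd (card {i. i < r \<and> i \<noteq> j \<and> c (idx z i) ! (piece i j * b + u)}))"
    for c :: "nat \<times> nat \<Rightarrow> bits"
  define enc where "enc k c = map (tx c) (es k)" for k c
  define len where "len k = card (E k)" for k
  have enc: "enc k (restrict v ({..<Q} \<times> W k)) = map (tx v) (es k)" for k v
    unfolding enc_def
  proof (rule map_cong[OF refl])
    fix e assume "e \<in> set (es k)"
    then obtain z j u where e: "e = (z, j, u)" "z \<in> Z" "j < r" "node z j = k"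
      by (auto simp: es E_def)
    \<comment> \<open>Only IVAs wanted at positions other than \<open>j\<close> enter the sum, and
      by \<open>known\<close> the transmitting node can compute them all.\<close>
    have "{i. i < r \<and> i \<noteq> j \<and> restrict v ({..<Q} \<times> W k) (idx z i) ! (piece i j * b + u)} =
      {i. i < r \<and> i \<noteq> j \<and> v (idx z i) ! (piece i j * b + u)}"
      using known[of z _ j] e by auto
    then show "tx (restrict v ({..<Q} \<times> W k)) e = tx v e"
      by (simp add: tx_def e)
  qed
  have "\<exists>S. cdc_scheme K N Q T S \<and> stored S = W \<and> assigned S = A \<and> msg_len S = len \<and>
    encode S = enc"
  proof (rule cdc_scheme_if_determined)
    fix k v assume "k < K" "v \<in> iva_families N Q T"
    show "length (enc k (restrict v ({..<Q} \<times> W k))) = len k"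
      using distinct_card[OF es(2), of k] by (simp add: enc len_def es)
  next
    fix k v v' q n
    assume k: "k < K" and v: "v \<in> iva_families N Q T" "v' \<in> iva_families N Q T"
      and loc: "restrict v ({..<Q} \<times> W k) = restrict v' ({..<Q} \<times> W k)"
      and eq: "\<And>j. j < K \<Longrightarrow> enc j (restrict v ({..<Q} \<times> W j)) =
        enc j (restrict v' ({..<Q} \<times> W j))"
      and q: "q \<in> A k" and n: "n < N"
    have same: "v p = v' p" if "p \<in> {..<Q} \<times> W k" for p
      using loc that by (metis restrict_apply')
    have qQ: "q < Q" using bounds(2)[OF k] q by auto
    show "v (q, n) = v' (q, n)"
    proof (cases "n \<in> W k")
      case True
      then show ?thesis using same qQ by simp
    next
      case False
      then obtain z i where z: "z \<in> Z" "i < r" "node z i = k" "idx z i = (q, n)"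
        using served k q n by blast
      have lens: "length (v (q, n)) = T" "length (v' (q, n)) = T"
        using v qQ n by (auto simp: iva_families_def)
      show ?thesis
      proof (rule nth_equalityI)
        fix u' assume "u' < length (v (q, n))"
        then have u': "u' < (r - 1) * b" by (simp add: lens T)
        then have "0 < b" by (cases b) auto
        define c where "c = u' div b"
        define u where "u = u' mod b"
        \<comment> \<open>The position in charge of piece \<open>c\<close> of the IVA wanted at
          \<open>i\<close>: the inverse of \<open>piece i\<close> on the positions other than
          \<open>i\<close>.\<close>
        define j where "j = (if c < i then c else c + 1)"
        have c: "c < r - 1" using u' \<open>0 < b\<close> by (simp add: c_def less_mult_imp_div_less)
        have j: "j < r" "j \<noteq> i" "piece i j = c"
          using c z(2) by (auto simp: j_def piece_def)
        have u: "u < b" "c * b + u = u'"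
          using \<open>0 < b\<close> by (auto simp: u_def c_def)
        define B where "B v = {i'. i' < r \<and> i' \<noteq> j \<and> v (idx z i') ! (piece i' j * b + u)}"
          for v :: "nat \<times> nat \<Rightarrow> bits"
        have "(z, j, u) \<in> set (es (node z j))"
          using z j u by (simp add: es E_def)
        moreover have "map (tx v) (es (node z j)) = map (tx v') (es (node z j))"
          using eq[of "node z j"] node_less[OF z(1) j(1)] by (simp add: enc)
        ultimately have "tx v (z, j, u) = tx v' (z, j, u)" by simp
        then have odd: "odd (card (B v)) \<longleftrightarrow> odd (card (B v'))"
          by (simp add: tx_def B_def)
        \<comment> \<open>Node \<open>k\<close> sits at position \<open>i\<close>, so it knows every
          other summand. The received parity then decides the one unknown bit.\<close>
        have "v (idx z i') = v' (idx z i')" if "i' < r" "i' \<noteq> i" for i'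
          using known[OF z(1) that(1) z(2) that(2)] z(3) by (intro same) simp
        then have rest: "B v - {i} = B v' - {i}"
          by (auto simp: B_def)
        have card: "card (B w) = (if i \<in> B w then Suc (card (B w - {i})) else card (B w - {i}))"
          for w
        proof (cases "i \<in> B w")
          case True
          have "finite (B w)" by (simp add: B_def)
          from card.remove[OF this True] show ?thesis using True by (simp only: if_True)
        qed simp
        have "i \<in> B v \<longleftrightarrow> i \<in> B v'"
          using odd unfolding card[of v] card[of v'] rest by (simp only: even_Suc split: if_splits) blast+
        then show "v (q, n) ! u' = v' (q, n) ! u'"
          using z j u by (simp add: B_def)
      qed (simp add: lens)
    qed
  qed (use bounds in auto)
  moreover have "(\<Sum>k<K. len k) = card Z * (r * b)"
  proof -
    \<comment> \<open>Each triple of a group, a position and an offset is a slot of exactly one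
      node.\<close>
    have "(\<Sum>k<K. card (E k)) = card (\<Union>k<K. E k)"
      using finE by (intro card_UN_disjoint[symmetric]) (auto simp: E_def)
    also have "(\<Union>k<K. E k) = Z \<times> {..<r} \<times> {..<b}"
      using node_less by (auto simp: E_def)
    finally show ?thesis
      by (simp add: len_def card_cartesian_product)
  qed
  ultimately show ?thesis by metis
qed

section \<open>Words with zero sum\<close>

definition all_words :: "nat \<Rightarrow> nat \<Rightarrow> (nat \<Rightarrow> nat) set" where
  "all_words m r = {..<r} \<rightarrow>\<^sub>E {..<m}"

definition codewords :: "nat \<Rightarrow> nat \<Rightarrow> (nat \<Rightarrow> nat) set" where
  "codewords m r = {x \<in> all_words m r. m dvd (\<Sum>j<r. x j)}"

text \<open>Subtracts the sum of the word from letter \<open>i\<close> modulo \<open>m\<close>; the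
  factor \<open>m - 1\<close> plays the role of -1 in the naturals.\<close>

definition complete_at :: "nat \<Rightarrow> nat \<Rightarrow> nat \<Rightarrow> (nat \<Rightarrow> nat) \<Rightarrow> nat \<Rightarrow> nat" where
  "complete_at m r i y = y(i := (y i + (m - 1) * (\<Sum>j<r. y j)) mod m)"

lemma finite_all_words: "finite (all_words m r)"
  by (simp add: all_words_def finite_PiE)

lemma finite_codewords: "finite (codewords m r)"
  by (simp add: codewords_def finite_all_words)

lemma card_all_words: "card (all_words m r) = m ^ r"
  by (simp add: all_words_def card_PiE)

lemma all_words_upd: "y \<in> all_words m r \<Longrightarrow> i < r \<Longrightarrow> a < m \<Longrightarrow> y(i := a) \<in> all_words m r"
  by (auto simp: all_words_def PiE_iff extensional_def)

lemma sum_upd: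
  fixes y :: "nat \<Rightarrow> nat"
  assumes "i < r"
  shows "(\<Sum>j<r. (y(i := a)) j) = a + (\<Sum>j\<in>{..<r} - {i}. y j)"
proof -
  have "(\<Sum>j<r. (y(i := a)) j) = (y(i := a)) i + (\<Sum>j\<in>{..<r} - {i}. (y(i := a)) j)"
    using assms by (intro sum.remove) auto
  also have "(\<Sum>j\<in>{..<r} - {i}. (y(i := a)) j) = (\<Sum>j\<in>{..<r} - {i}. y j)"
    by (intro sum.cong) auto
  finally show ?thesis by simp
qed

text \<open>With \<open>S\<close> the old sum, the new sum is congruent to
  \<open>S + (m - 1) * S = m * S\<close>.\<close>

lemma complete_at_codeword:
  assumes y: "y \<in> all_words m r" and i: "i < r" and m: "0 < m"
  shows "complete_at m r i y \<in> codewords m r"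
proof -
  define R where "R = (\<Sum>j\<in>{..<r} - {i}. y j)"
  define S where "S = (\<Sum>j<r. y j)"
  have S: "S = y i + R"
    using sum_upd[OF i, of y "y i"] by (simp add: S_def R_def)
  have "m dvd (y i + (m - 1) * S) mod m + R \<longleftrightarrow> m dvd (y i + (m - 1) * S) + R"
    by (simp add: dvd_eq_mod_eq_0 mod_add_left_eq)
  moreover have "(y i + (m - 1) * S) + R = m * S"
    using m S by (cases m) auto
  ultimately have "m dvd (y i + (m - 1) * S) mod m + R" by simp
  then show ?thesis
    unfolding codewords_def complete_at_def S_def[symmetric]
    using all_words_upd[OF y i] m by (simp add: sum_upd[OF i] R_def del: fun_upd_apply)
qed

text \<open>The other letters cancel in the two zero sums, so the letters at \<open>i\<close> are
  congruent modulo \<open>m\<close>, and both are below \<open>m\<close>. Hence changing one letter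
  of a codeword always leaves the code.\<close>

lemma codeword_upd_unique:
  assumes x: "x \<in> codewords m r" and x': "x(i := a) \<in> codewords m r" and i: "i < r"
  shows "x i = a"
proof -
  define R where "R = (\<Sum>j\<in>{..<r} - {i}. x j)"
  have "m dvd x i + R"
    using x sum_upd[OF i, of x "x i"] by (simp add: codewords_def R_def)
  moreover have "m dvd a + R"
    using x' sum_upd[OF i, of x a] by (simp add: codewords_def R_def)
  ultimately have "(x i + R) mod m = (a + R) mod m"
    by (simp add: dvd_eq_mod_eq_0)
  then have "x i mod m = a mod m"
    by (simp add: nat_mod_eq_iff)
  moreover have "x i < m"
    using x i by (auto simp: codewords_def all_words_def)
  moreover have "a < m"
    using PiE_mem[of "x(i := a)" "{..<r}" "\<lambda>_. {..<m}" i] x' i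
    by (auto simp: codewords_def all_words_def)
  ultimately show ?thesis by simp
qed

text \<open>Both sides are codewords that can differ at \<open>i\<close> only. This recovers a file
  from the group formed for a node at which it is missing.\<close>

lemma complete_at_upd_codeword:
  assumes x: "x \<in> codewords m r" and i: "i < r" and a: "a < m"
  shows "complete_at m r i (x(i := a)) = x"
proof -
  have "x(i := a) \<in> all_words m r"
    using x i a all_words_upd by (auto simp: codewords_def)
  then have "complete_at m r i (x(i := a)) \<in> codewords m r"
    using a by (intro complete_at_codeword i) auto
  then obtain b where b: "complete_at m r i (x(i := a)) = x(i := b)" "x(i := b) \<in> codewords m r"
    by (auto simp: complete_at_def)
  then have "x i = b" using codeword_upd_unique[OF x _ i] by simp
  then show ?thesis using b by auto
qed

text \<open>The first \<open>r - 1\<close> letters are free and the last one is forced: put a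
  placeholder 0 there and complete it.\<close>

lemma card_codewords:
  assumes m: "0 < m" and r: "0 < r"
  shows "card (codewords m r) = m ^ (r - 1)"
proof -
  define i where "i = r - 1"
  have i: "i < r" "{..<r} = insert i {..<i}" using r by (auto simp: i_def)
  have zero: "y(i := 0) \<in> all_words m r" if "y \<in> all_words m i" for y
    using that m by (auto simp: all_words_def PiE_iff extensional_def i(2))
  have "bij_betw (\<lambda>y. complete_at m r i (y(i := 0))) (all_words m i) (codewords m r)"
  proof (rule bij_betwI[where g = "\<lambda>x. restrict x {..<i}"])
    show "(\<lambda>y. complete_at m r i (y(i := 0))) \<in> all_words m i \<rightarrow> codewords m r"
      using complete_at_codeword zero i m by blast
    show "(\<lambda>x. restrict x {..<i}) \<in> codewords m r \<rightarrow> all_words m i"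
      by (auto simp: codewords_def all_words_def i(2))
    show "restrict (complete_at m r i (y(i := 0))) {..<i} = y" if "y \<in> all_words m i" for y
      using that by (auto simp: complete_at_def all_words_def PiE_iff extensional_def)
    show "complete_at m r i ((restrict x {..<i})(i := 0)) = x" if x: "x \<in> codewords m r" for x
    proof -
      have "(restrict x {..<i})(i := 0) = x(i := 0)"
        using x by (auto simp: codewords_def all_words_def PiE_iff extensional_def i(2))
      then show ?thesis using complete_at_upd_codeword x i m by metis
    qed
  qed
  from bij_betw_same_card[OF this] show ?thesis
    by (simp add: card_all_words i_def)
qed

text \<open>Node \<open>(i, a)\<close> is encoded as the number \<open>i * m + a\<close>, from which
  \<open>div\<close> and \<open>mod\<close> read off position and letter.\<close>

lemma div_mod_node:
  assumes "y \<in> all_words m r" "i < r"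
  shows "(i * m + y i) div m = i" "(i * m + y i) mod m = y i" "i * m + y i < r * m"
proof -
  have y: "y i < m" using assms by (auto simp: all_words_def)
  then show "(i * m + y i) div m = i" "(i * m + y i) mod m = y i" by auto
  have "i * m + y i < Suc i * m" using y by simp
  also have "\<dots> \<le> r * m" using assms(2) by (intro mult_right_mono) auto
  finally show "i * m + y i < r * m" .
qed

text \<open>A word selects exactly one node at each of the \<open>r\<close> positions.\<close>

lemma card_nodes_of_word:
  assumes y: "y \<in> all_words m r"
  shows "card {k\<in>{..<r * m}. y (k div m) = k mod m} = r"
proof -
  have "{k\<in>{..<r * m}. y (k div m) = k mod m} = (\<lambda>i. i * m + y i) ` {..<r}"
  proof (intro equalityI subsetI)
    fix k assume k: "k \<in> {k\<in>{..<r * m}. y (k div m) = k mod m}"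
    then have "k div m < r" by (auto simp: less_mult_imp_div_less)
    moreover have "k = k div m * m + y (k div m)" using k by simp
    ultimately show "k \<in> (\<lambda>i. i * m + y i) ` {..<r}" by blast
  qed (use div_mod_node[OF y] in auto)
  moreover have "inj_on (\<lambda>i. i * m + y i) {..<r}"
    using div_mod_node(1)[OF y] by (intro inj_onI) (metis lessThan_iff)
  ultimately show ?thesis by (simp add: card_image)
qed

section \<open>Cyclic assignment of the output functions\<close>

text \<open>Node \<open>k\<close> takes the \<open>p\<close> cyclically consecutive functions
  starting at \<open>k\<close>. Function \<open>q\<close> is then taken by the residues
  \<open>q - l\<close> with \<open>l < p\<close>, which are distinct because
  \<open>p \<le> Q\<close>, and each residue has \<open>d\<close> representatives below
  \<open>Q * d\<close>.\<close>

lemma card_cyclic_assignment: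
  fixes Q p d q :: nat
  assumes "p \<le> Q" "q < Q"
  shows "card {k. k < Q * d \<and> q \<in> (\<lambda>l. (k + l) mod Q) ` {..<p}} = p * d"
proof -
  \<comment> \<open>The \<open>c\<close>-th number with residue \<open>q - l\<close>; adding
    \<open>Q\<close> keeps the subtraction from truncating.\<close>
  define f where "f = (\<lambda>(l, c). (q + Q - l) mod Q + c * Q)"
  have key: "((q + Q - l) mod Q + l) mod Q = q" if "l < p" for l
    using that assms by (simp add: mod_add_left_eq)
  have f: "(f (l, c) + l) mod Q = q" "f (l, c) div Q = c" "f (l, c) < Q * d"
    if "l < p" "c < d" for l c
  proof -
    have "(f (l, c) + l) mod Q = ((q + Q - l) mod Q + l + c * Q) mod Q"
      by (simp add: f_def ac_simps)
    also have "\<dots> = ((q + Q - l) mod Q + l) mod Q"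
      by (rule mod_mult_self1)
    finally show "(f (l, c) + l) mod Q = q"
      using key that by simp
    have less: "(q + Q - l) mod Q < Q" using assms by simp
    then show "f (l, c) div Q = c" by (simp add: f_def)
    have "f (l, c) < Suc c * Q" using less by (simp add: f_def)
    also have "\<dots> \<le> d * Q" using that by (intro mult_right_mono) auto
    finally show "f (l, c) < Q * d" by (simp add: mult.commute)
  qed
  have cancel: "l = l'" if "(k + l) mod Q = (k + l') mod Q" "l < p" "l' < p" for k l l'
  proof -
    have "l mod Q = l' mod Q" using that(1) by (simp add: nat_mod_eq_iff)
    then show ?thesis using that assms by simp
  qed
  have "{k. k < Q * d \<and> q \<in> (\<lambda>l. (k + l) mod Q) ` {..<p}} = f ` ({..<p} \<times> {..<d})"
  proof (intro equalityI subsetI)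
    fix k assume "k \<in> {k. k < Q * d \<and> q \<in> (\<lambda>l. (k + l) mod Q) ` {..<p}}"
    then obtain l where k: "k < Q * d" and l: "l < p" "(k + l) mod Q = q" by auto
    have "(q + Q - l) mod Q = ((k + l) mod Q + (Q - l)) mod Q"
      using l assms by simp
    also have "\<dots> = (k + l + (Q - l)) mod Q"
      by (rule mod_add_left_eq)
    also have "\<dots> = k mod Q"
      using l assms by simp
    finally have "f (l, k div Q) = k"
      by (simp add: f_def)
    moreover have "k div Q < d"
      using k by (simp add: less_mult_imp_div_less mult.commute)
    ultimately show "k \<in> f ` ({..<p} \<times> {..<d})"
      using l by force
  next
    fix k assume "k \<in> f ` ({..<p} \<times> {..<d})"
    then obtain l c where "l < p" "c < d" "k = f (l, c)" by auto
    then show "k \<in> {k. k < Q * d \<and> q \<in> (\<lambda>l. (k + l) mod Q) ` {..<p}}"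
      using f(1,3)[of l c] by (auto intro!: image_eqI[of _ _ l])
  qed
  moreover have "inj_on f ({..<p} \<times> {..<d})"
  proof (rule inj_onI, clarsimp)
    fix l c l' c' assume *: "l < p" "c < d" "l' < p" "c' < d" "f (l, c) = f (l', c')"
    then show "l = l' \<and> c = c'"
      using f(1,2)[of l c] f(1,2)[of l' c'] cancel[of "f (l, c)" l l'] by auto
  qed
  ultimately show ?thesis by (simp add: card_image card_cartesian_product)
qed

section \<open>Assembly of the schemes and their loads\<close>

theorem mainTheorem3:
  fixes K t s r N Q T :: nat and L :: real
  assumes "0 < K" and "0 < s" and "2 \<le> t" and "t dvd K" and "s \<le> K" and "r = t"
    and "N = (K div r) ^ (r - 1)" and "Q = K div gcd K s" and "0 < T"
    and "L = real s / (real r - 1) * (1 - real r / real K)"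
  shows "\<exists>W A.
    computation_load K N W = real r \<and>
    (\<forall>q<Q. card (computing_nodes K A q) = s) \<and>
    ((r - 1) dvd T \<longrightarrow>
      (\<exists>S. cdc_scheme K N Q T S \<and> stored S = W \<and> assigned S = A \<and>
        communication_load K N Q T S = L)) \<and>
    (L > 1 \<longrightarrow>
      (\<exists>S. cdc_scheme K N Q T S \<and> stored S = W \<and> assigned S = A \<and>
        uncoded_multicast K N Q S \<and> communication_load K N Q T S = 1)) \<and>
    ((r - 1) dvd T \<or> L > 1 \<longrightarrow>
      (\<exists>S. cdc_scheme K N Q T S \<and> stored S = W \<and> assigned S = A \<and>
        communication_load K N Q T S = min L 1))"
proof -
  define m where "m = K div r"
  define d where "d = gcd K s"
  \<comment> \<open>The number of functions per node. With \<open>K = Q * d\<close> and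
    \<open>s = p * d\<close>, the cyclic assignment gives every function to \<open>s\<close>
    nodes.\<close>
  define p where "p = s div d"
  have r: "2 \<le> r" using assms by simp
  have K: "K = r * m" using assms by (simp add: m_def)
  have m: "0 < m" using \<open>0 < K\<close> K by (cases m) auto
  have d: "0 < d" using \<open>0 < s\<close> by (simp add: d_def)
  have KQ: "K = Q * d" using assms by (simp add: d_def)
  have s: "s = p * d" by (simp add: p_def d_def)
  have Q: "0 < Q" using KQ \<open>0 < K\<close> by (cases Q) auto
  have pQ: "p \<le> Q" using \<open>s \<le> K\<close> d by (simp add: KQ s)
  have N: "N = m ^ (r - 1)" "0 < N" using assms m by (simp_all add: m_def)
  obtain e where e: "bij_betw e {..<N} (codewords m r)"
    using card_codewords[OF m, of r] r N
      finite_same_card_bij[OF finite_lessThan[of N] finite_codewords[of m r]] by auto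
  define ind where "ind x = inv_into {..<N} e x" for x
  have ind: "ind x < N" "e (ind x) = x" if "x \<in> codewords m r" for x
    using bij_betwE[OF bij_betw_inv_into[OF e]] bij_betw_inv_into_right[OF e] that
    by (auto simp: ind_def)
  have ind_e: "ind (e n) = n" if "n < N" for n
    using bij_betw_inv_into_left[OF e] that by (simp add: ind_def)
  have e_code: "e n \<in> codewords m r" if "n < N" for n
    using bij_betwE[OF e] that by blast
  then have e_word: "e n \<in> all_words m r" if "n < N" for n
    using that by (simp add: codewords_def)

  define W where "W k = {n\<in>{..<N}. e n (k div m) = k mod m}" for k
  define A where "A k = (\<lambda>l. (k + l) mod Q) ` {..<p}" for k
  have bounds: "W k \<subseteq> {..<N}" "A k \<subseteq> {..<Q}" for k
    using Q by (auto simp: W_def A_def)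
  \<comment> \<open>Double counting again: every file is stored at \<open>r\<close> nodes.\<close>
  have "(\<Sum>k<K. card (W k)) = r * card {..<N}"
    unfolding W_def using card_nodes_of_word[OF e_word] by (intro sum_multicount) (auto simp: K)
  then have comp: "computation_load K N W = real r"
    using N(2) by (simp add: computation_load_def flip: of_nat_sum)
  have computing: "\<forall>q<Q. card (computing_nodes K A q) = s"
    using card_cyclic_assignment[OF pQ, of _ d] by (simp add: computing_nodes_def A_def KQ s)

  have uncoded: "\<exists>S. cdc_scheme K N Q T S \<and> stored S = W \<and> assigned S = A \<and>
    uncoded_multicast K N Q S \<and> communication_load K N Q T S = 1"
  proof (rule uncoded_multicast_scheme)
    \<comment> \<open>The sender of a file is its node at position 0, whose number is just the
      letter \<open>e n 0\<close>.\<close>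
    fix n assume "n < N"
    with div_mod_node[OF e_word, of n 0] r show "e n 0 < K" "n \<in> W (e n 0)"
      by (auto simp: W_def K)
  qed (use bounds N Q \<open>0 < T\<close> in auto)

  have coded: "\<exists>S. cdc_scheme K N Q T S \<and> stored S = W \<and> assigned S = A \<and>
    communication_load K N Q T S = L" if dvd: "(r - 1) dvd T"
  proof -
    \<comment> \<open>Divisibility lets an IVA be cut into \<open>r - 1\<close> pieces of
      \<open>b\<close> whole bits.\<close>
    obtain b where b: "T = (r - 1) * b" using dvd by blast
    define Y where "Y = all_words m r - codewords m r"
    define nd where "nd = (\<lambda>(l :: nat, y). \<lambda>i. i * m + y i :: nat)"
    \<comment> \<open>In group \<open>(l, y)\<close> the node at position \<open>i\<close> wants its
      \<open>l\<close>-th function on the file obtained by correcting \<open>y\<close> at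
      \<open>i\<close>.\<close>
    define idx where "idx = (\<lambda>(l, y). \<lambda>i. ((i * m + y i + l) mod Q, ind (complete_at m r i y)))"
    have "\<exists>S. cdc_scheme K N Q T S \<and> stored S = W \<and> assigned S = A \<and>
      (\<Sum>k<K. msg_len S k) = card ({..<p} \<times> Y) * (r * b)"
    proof (rule coded_multicast_scheme[where node = nd and idx = idx])
      show "finite ({..<p} \<times> Y)" by (simp add: Y_def finite_all_words)
      fix z i assume "z \<in> {..<p} \<times> Y" and i: "i < r"
      then obtain l y where z: "z = (l, y)" "l < p" "y \<in> all_words m r"
        by (auto simp: Y_def)
      show "nd z i < K"
        using div_mod_node[OF z(3) i] by (simp add: nd_def z K)
      \<comment> \<open>Completing at \<open>i\<close> leaves letter \<open>j\<close> alone, so the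
        file is stored at the group's node at position \<open>j\<close>.\<close>
      fix j assume j: "j < r" "i \<noteq> j"
      then show "idx z i \<in> {..<Q} \<times> W (nd z j)"
        using ind[OF complete_at_codeword[OF z(3) i m]] div_mod_node[OF z(3) j(1)] Q
        by (auto simp: idx_def nd_def z W_def) (simp add: complete_at_def)
    next
      fix k q n assume k: "k < K" and q: "q \<in> A k" and n: "n < N" "n \<notin> W k"
      define i where "i = k div m"
      define a where "a = k mod m"
      \<comment> \<open>The group serving this request: overwrite letter \<open>i\<close> of the
        missing file by the node's own letter. As the letters differ, the result is not a codeword,
        and completing at \<open>i\<close> returns the file.\<close>
      define y where "y = (e n)(i := a)"
      obtain l where l: "l < p" "q = (k + l) mod Q" using q by (auto simp: A_def)
      have i: "i < r" using k by (simp add: i_def K less_mult_imp_div_less)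
      have a: "a < m" using m by (simp add: a_def)
      have ne: "e n i \<noteq> a" using n by (simp add: W_def i_def a_def)
      have "y \<in> Y"
        using codeword_upd_unique[OF e_code[OF n(1)] _ i] all_words_upd[OF e_word[OF n(1)] i a] ne
        by (auto simp: Y_def y_def)
      moreover have "i * m + y i = k" by (simp add: y_def i_def a_def)
      moreover have "ind (complete_at m r i y) = n"
        using complete_at_upd_codeword[OF e_code[OF n(1)] i a] ind_e n by (simp add: y_def)
      ultimately show "\<exists>z\<in>{..<p} \<times> Y. \<exists>i<r. nd z i = k \<and> idx z i = (q, n)"
        using l i by (intro bexI[of _ "(l, y)"] exI[of _ i]) (auto simp: nd_def idx_def)
    qed (use bounds b in auto)
    then obtain S where S: "cdc_scheme K N Q T S" "stored S = W" "assigned S = A"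
      and len: "(\<Sum>k<K. msg_len S k) = card ({..<p} \<times> Y) * (r * b)" by blast
    have "card Y = m ^ r - N"
      using card_codewords[OF m, of r] r finite_codewords
      by (simp add: Y_def N card_Diff_subset codewords_def card_all_words)
    also have "m ^ r = m * N"
      using r by (simp add: N flip: power_Suc)
    finally have "real (card Y) = real N * (real m - 1)"
      using m by (simp add: of_nat_diff algebra_simps)
    then have "communication_load K N Q T S =
        real p * (real N * (real m - 1)) * (real r * real b) / (real Q * real N * real T)"
      by (simp add: communication_load_def len card_cartesian_product flip: of_nat_sum)
    also have "\<dots> = real p * (real m - 1) * real r / (real Q * (real r - 1))"
    proof -
      have "real T = (real r - 1) * real b" using r by (simp add: b of_nat_diff)
      moreover have "0 < b" using \<open>0 < T\<close> b by (cases b) auto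
      moreover have "w * (n * c) * (y * f) / (x * n * (z * f)) = w * c * y / (x * z)"
        if "n \<noteq> 0" "f \<noteq> 0" for w n c y f x z :: real
        using that by (simp add: divide_simps)
      ultimately show ?thesis using N(2) by simp
    qed
    also have "\<dots> = L"
    proof -
      \<comment> \<open>Both products equal \<open>K\<close>, so p/Q = pd/(Qd) = s/K.\<close>
      have "real r * real m = real Q * real d"
        using K KQ by (metis of_nat_mult)
      then have ratio: "real p / real Q = real s / (real r * real m)"
        using d by (simp add: s)
      have "real p * (real m - 1) * real r / (real Q * (real r - 1)) =
          real p / real Q * ((real m - 1) * real r / (real r - 1))"
        by (simp add: mult.assoc)
      also have "\<dots> = real s / (real r * real m) * ((real m - 1) * real r / (real r - 1))"
        by (simp only: ratio)
      also have "\<dots> = L"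
        using r m by (simp add: assms(10) K field_simps)
      finally show ?thesis .
    qed
    finally show ?thesis using S by blast
  qed
  have best: "\<exists>S. cdc_scheme K N Q T S \<and> stored S = W \<and> assigned S = A \<and>
    communication_load K N Q T S = min L 1" if "(r - 1) dvd T \<or> L > 1"
  \<comment> \<open>For \<open>L > 1\<close> the minimum is 1, attained uncoded for every
    \<open>T\<close>; otherwise \<open>r - 1\<close> divides \<open>T\<close> and the coded scheme
    attains \<open>L\<close>.\<close>
  proof (cases "L > 1")
    case True
    then show ?thesis using uncoded by auto
  next
    case False
    then show ?thesis using coded that by auto
  qed
  show ?thesis
    by (rule exI[of _ W], rule exI[of _ A], intro conjI impI)
      (rule comp computing coded uncoded best; assumption)+
qed

end
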